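(* Let $n_1,\dots,n_k\ge 1$ be integers, $N=n_1+\cdots+n_k$, and let $\lambda_i, a_{in}\in\mathbb{C}$ ($1\le i\le k$, $0\le n\le n_i-1$). Put $f_{[A_i]}(x)=\sum_{n=0}^{n_i-1}a_{in}x^n$, $A_i=f_{[A_i]}(J_{n_i}(0))$, $J=\bigoplus_{i=1}^k J_{n_i}(\lambda_i)$, $A=\bigoplus_{i=1}^k A_i$, and let $E$ be the $N\times N$ identity matrix. Let $z_3\in\mathbb{C}$ satisfy $1+z_3a_{i1}\neq 0$ for all $i$ with $n_i\ge2$. For each $i$ define $$g_{i}(x)=\lambda_i+x+z_3f_{[A_i]}(x),$$ and let $g_i^{-1}$ denote the compositional inverse of $g_i$ (modulo $x^{n_i}$). Then there exists an invertible $N\times N$ complex matrix $S$ such that $$S^{-1}(J+z_3A)S=\bigoplus_{i=1}^k J_{n_i}(\lambda_i+z_3a_{i0}),\qquad S^{-1}AS=\bigoplus_{i=1}^k A_i''',$$ where $$A_i'''=\bigl(f_{[A_i]}\circ g_i^{-1}\bigr)\bigl(J_{n_i}(\lambda_i+z_3a_{i0})\bigr).$$ In particular the triples $(E,J,A)$ and $\bigl(E,\bigoplus_i J_{n_i}(\lambda_i+z_3a_{i0}),\bigoplus_i A_i'''\bigr)$ are SLOCC equivalent.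
   Context: $J_n(\lambda)$ is the $n\times n$ upper triangular Jordan block with eigenvalue $\lambda$ (ones on the superdiagonal), so $J_n(\lambda)=\lambda+J_n(0)$ and $J_n(0)^n=0$. Compositional inverse: if $g(x)=\mu+c_1x+c_2x^2+\cdots$ is a polynomial or power series with $c_1\neq0$ (this condition is vacuous when $n=1$), then $g^{-1}(t)$ is a polynomial in $(t-\mu)$ without constant term, determined modulo $(t-\mu)^n$ by $g^{-1}(g(x))\equiv x \pmod{x^n}$ (when $n=1$ it is $0$). The matrix $(f\circ g^{-1})(J_n(\mu))$ is $f(g^{-1}(J_n(\mu)))$, obtained by substituting $t-\mu=J_n(0)$; it is well defined because $J_n(0)^n=0$. A pure state of a $3\times N\times N$ system is represented by a triple $(\Gamma_1,\Gamma_2,\Gamma_3)$ of complex $N\times N$ matrices. Two triples $(\Gamma_1,\Gamma_2,\Gamma_3)$ and $(\Gamma_1',\Gamma_2',\Gamma_3')$ are SLOCC equivalent if there are an invertible complex $3\times3$ matrix $T=(T_{ij})$ and invertible complex $N\times N$ matrices $P,Q$ with $\sum_{j=1}^3T_{ij}P\Gamma_jQ=\Gamma_i'$ for $i=1,2,3$. *)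

theory Defs
  imports
    "HOL-Computational_Algebra.Polynomial_FPS"
    "Jordan_Normal_Form.Jordan_Normal_Form"
    "HOL.Complex"
begin

text \<open>
  The value \<open>p(M)\<close> of a polynomial at a square matrix, as the entrywise sum
  \<open>\<Sum>m. p\<^sub>m M\<^sup>m\<close> (matrices of varying dimension do not form a type-class monoid).
\<close>

definition poly_mat :: "'a::comm_ring_1 poly \<Rightarrow> 'a mat \<Rightarrow> 'a mat" where
  "poly_mat p M =
     mat (dim_row M) (dim_row M) (\<lambda>(i, j). \<Sum>m\<le>degree p. coeff p m * (M ^\<^sub>m m) $$ (i, j))"

text \<open>
  For \<open>g = \<mu> + c\<^sub>1 x + \<dots>\<close>, the compositional inverse modulo \<open>(t - \<mu>)\<^sup>n\<close> is the
  representative of degree below \<open>n\<close>, written as a polynomial in \<open>t\<close>: the series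
  \<open>fps_inv (g - \<mu>)\<close> is cut off and \<open>t - \<mu>\<close> is substituted.  It is the zero
  polynomial for \<open>n = 1\<close>, whatever \<open>c\<^sub>1\<close> is.
  The lemmas below show that it is an inverse of \<open>g\<close>, unique modulo \<open>(t - \<mu>)\<^sup>n\<close>.
\<close>

definition comp_inverse :: "nat \<Rightarrow> 'a::field poly \<Rightarrow> 'a poly" where
  "comp_inverse n g =
     pcompose (truncate_fps n (fps_inv (fps_of_poly (g - [:coeff g 0:])))) [:- coeff g 0, 1:]"

lemma comp_inverse_no_const:
  "poly (comp_inverse n g) (coeff g 0) = 0"
  by (simp add: comp_inverse_def poly_pcompose poly_0_coeff_0 coeff_truncate_fps fps_inv_def)

lemma pcompose_shift: "pcompose (pcompose p [:- c, 1:]) q = pcompose p (q - [:c:])"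
  for p q :: "'a::comm_ring_1 poly"
proof -
  have "pcompose [:- c, 1:] q = q - [:c:]" by (simp add: pcompose_pCons algebra_simps flip: minus_pCons)
  then show ?thesis by (simp only: pcompose_assoc[symmetric])
qed

lemma comp_inverse:
  fixes g :: "'a::field poly"
  assumes "n \<ge> 1" and "n \<ge> 2 \<Longrightarrow> coeff g 1 \<noteq> 0"
  shows "monom 1 n dvd pcompose (comp_inverse n g) g - [:0, 1:]"
proof -
  define G where "G = g - [:coeff g 0:]"
  define F where "F = fps_inv (fps_of_poly G)"
  have G0: "coeff G 0 = 0" by (simp add: G_def)
  have *: "pcompose (comp_inverse n g) g = pcompose (truncate_fps n F) G"
    by (simp add: comp_inverse_def pcompose_shift G_def F_def)
  have **: "fps_of_poly (pcompose (truncate_fps n F) G) = fps_of_poly (truncate_fps n F) oo fps_of_poly G"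
    using G0 by (simp add: fps_of_poly_pcompose)
  have "coeff (pcompose (truncate_fps n F) G - [:0, 1:]) j = 0" if j: "j < n" for j
  proof -
    have "coeff (pcompose (truncate_fps n F) G) j = fps_nth (fps_of_poly (truncate_fps n F) oo fps_of_poly G) j"
      by (simp only: **[symmetric] fps_of_poly_nth)
    also have "\<dots> = fps_nth (F oo fps_of_poly G) j"
      using j by (auto simp: fps_compose_nth coeff_truncate_fps intro!: sum.cong)
    also have "\<dots> = fps_nth fps_X j"
    proof (cases "n \<ge> 2")
      case True
      then have "coeff G 1 \<noteq> 0" using assms by (simp add: G_def)
      with G0 have "F oo fps_of_poly G = fps_X" unfolding F_def by (intro fps_inv) auto
      then show ?thesis by simp
    next
      case False
      with j have "j = 0" by simp
      then show ?thesis by (simp add: F_def fps_inv_def)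
    qed
    finally show ?thesis by (cases j) (auto simp: coeff_pCons split: nat.splits)
  qed
  then show ?thesis unfolding * by (subst monom_1_dvd_iff') auto
qed

lemma comp_inverse_unique:
  fixes g h :: "'a::field poly"
  assumes n: "n \<ge> 1" "n \<ge> 2 \<Longrightarrow> coeff g 1 \<noteq> 0"
    and h: "poly h (coeff g 0) = 0"
    and inv: "monom 1 n dvd pcompose h g - [:0, 1:]"
  shows "[:- coeff g 0, 1:] ^ n dvd h - comp_inverse n g"
proof -
  define c where "c = coeff g 0"
  define d where "d = h - comp_inverse n g"
  define m where "m = order c d"
  show ?thesis
  proof (cases "n = 1 \<or> d = 0")
    case True
    have "poly d c = 0" using h comp_inverse_no_const[of n g] by (simp add: d_def c_def)
    with True show ?thesis unfolding d_def[symmetric] c_def[symmetric]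
      by (auto simp: poly_eq_0_iff_dvd)
  next
    case False
    then have c1: "coeff g 1 \<noteq> 0" and d0: "d \<noteq> 0" using n by auto
    obtain q where q: "d = [:- c, 1:] ^ m * q" and nq: "\<not> [:- c, 1:] dvd q"
      using order_decomp[OF d0, of c] unfolding m_def by blast
    obtain u where u: "g - [:c:] = [:0, 1:] * u"
      using poly_eq_0_iff_dvd[of "g - [:c:]" 0] by (auto simp: poly_0_coeff_0 c_def)
    have u0: "coeff u 0 \<noteq> 0"
    proof -
      have "coeff (g - [:c:]) 1 = coeff u 0" unfolding u by simp
      with c1 show ?thesis by simp
    qed
    have "pcompose d g = (pcompose [:- c, 1:] g) ^ m * pcompose q g"
      by (simp add: q pcompose_mult pcompose_hom.hom_power)
    also have "pcompose [:- c, 1:] g = g - [:c:]" by (simp add: pcompose_pCons)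
    finally have d': "pcompose d g = monom 1 m * (u ^ m * pcompose q g)"
      by (simp only: u power_mult_distrib mult.assoc monom_altdef smult_1_left)
    have "poly q c \<noteq> 0" using nq by (simp add: poly_eq_0_iff_dvd)
    then have "coeff (u ^ m * pcompose q g) 0 \<noteq> 0"
      using u0 by (simp flip: poly_0_coeff_0 add: poly_pcompose c_def)
    then have nz: "coeff (pcompose d g) m \<noteq> 0" by (simp add: d' coeff_monom_mult)
    have "pcompose d g = (pcompose h g - [:0, 1:]) - (pcompose (comp_inverse n g) g - [:0, 1:])"
      by (simp add: d_def pcompose_diff)
    then have "monom 1 n dvd pcompose d g"
      using comp_inverse[of n g] n inv by (metis dvd_diff)
    then have "n \<le> m" using nz by (subst (asm) monom_1_dvd_iff') (meson not_le)
    then have "[:- c, 1:] ^ n dvd d" unfolding q by (intro dvd_mult2 le_imp_power_dvd)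
    then show ?thesis by (simp add: d_def c_def)
  qed
qed

text \<open>SLOCC equivalence of \<open>3 \<times> N \<times> N\<close> pure states; rows and columns of \<open>T\<close> are numbered from 0.\<close>

definition slocc_equiv ::
  "nat \<Rightarrow> complex mat \<times> complex mat \<times> complex mat \<Rightarrow>
   complex mat \<times> complex mat \<times> complex mat \<Rightarrow> bool" where
  "slocc_equiv N = (\<lambda>(G1, G2, G3) (H1, H2, H3).
     {G1, G2, G3, H1, H2, H3} \<subseteq> carrier_mat N N \<and>
     (\<exists>T \<in> carrier_mat 3 3. \<exists>P \<in> carrier_mat N N. \<exists>Q \<in> carrier_mat N N.
        invertible_mat T \<and> invertible_mat P \<and> invertible_mat Q \<and>
        (\<forall>i<3. T $$ (i, 0) \<cdot>\<^sub>m (P * G1 * Q) + T $$ (i, 1) \<cdot>\<^sub>m (P * G2 * Q)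
                 + T $$ (i, 2) \<cdot>\<^sub>m (P * G3 * Q) = [H1, H2, H3] ! i)))"

end

theory Submission
  imports Defs
begin

text \<open>
  For a power series \<open>p\<close>, let \<open>T p = p(J\<^sub>n(0))\<close>, and for a series \<open>q\<close> without constant term let
  \<open>R q\<close> be the matrix whose \<open>i\<close>-th row lists the coefficients of \<open>q\<^sup>i\<close>.  Reading a row vector as a
  series modulo \<open>x\<^sup>n\<close>, \<open>T p\<close> acts from the right as multiplication by \<open>p\<close> and \<open>R q\<close> as
  substitution of \<open>q\<close>; hence \<open>T p * R q = R q * T (p \<circ> q)\<close> and \<open>R p * R q = R (p \<circ> q)\<close>.
  If \<open>h\<close> is the compositional inverse of \<open>G = g - \<mu>\<close>, then \<open>R G\<close> and \<open>R h\<close> are mutually inverse,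
  and conjugation by \<open>R h\<close> takes \<open>T p\<close> to \<open>T (p \<circ> h)\<close>.  Each block is treated with
  \<open>p = g\<close>, where \<open>g \<circ> h = \<mu> + x\<close>, and with \<open>p = f\<close>.
\<close>

subsection \<open>Toeplitz and substitution matrices\<close>

definition toeplitz_mat :: "nat \<Rightarrow> 'a::comm_ring_1 fps \<Rightarrow> 'a mat" where
  "toeplitz_mat n p = mat n n (\<lambda>(i, j). if i \<le> j then fps_nth p (j - i) else 0)"

definition subst_mat :: "nat \<Rightarrow> 'a::comm_ring_1 fps \<Rightarrow> 'a mat" where
  "subst_mat n q = mat n n (\<lambda>(i, j). fps_nth (q ^ i) j)"

lemma toeplitz_mat_carrier [simp]: "toeplitz_mat n p \<in> carrier_mat n n"
  by (simp add: toeplitz_mat_def)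

lemma subst_mat_carrier [simp]: "subst_mat n q \<in> carrier_mat n n"
  by (simp add: subst_mat_def)

lemma toeplitz_mat_cong:
  assumes "\<And>j. j < n \<Longrightarrow> fps_nth p j = fps_nth q j"
  shows "toeplitz_mat n p = toeplitz_mat n q"
  using assms by (auto simp: toeplitz_mat_def)

lemma jordan_block_eq_toeplitz:
  "jordan_block n c = toeplitz_mat n (fps_of_poly [:c, 1:])"
  by (rule eq_matI) (auto simp: toeplitz_mat_def coeff_pCons split: nat.splits)

lemma toeplitz_mat_add_smult:
  "toeplitz_mat n p + c \<cdot>\<^sub>m toeplitz_mat n q = toeplitz_mat n (p + fps_const c * q)"
  by (rule eq_matI) (auto simp: toeplitz_mat_def)

text \<open>The sum is the row \<open>r\<close> times column \<open>j\<close> of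
  \<open>subst_mat n q\<close>. As \<open>q\<close> has no constant term, \<open>q ^ l\<close>
  vanishes below degree \<open>l\<close>, so only \<open>l \<le> j\<close> contributes and cutting
  off at \<open>n > j\<close> loses nothing of the composition.\<close>

lemma sum_fps_power_eq_compose:
  fixes r q :: "'a::comm_ring_1 fps"
  assumes "fps_nth q 0 = 0" "j < n"
  shows "(\<Sum>l<n. fps_nth r l * fps_nth (q ^ l) j) = fps_nth (r oo q) j"
proof -
  have "(\<Sum>l<n. fps_nth r l * fps_nth (q ^ l) j) = (\<Sum>l=0..j. fps_nth r l * fps_nth (q ^ l) j)"
    using assms by (intro sum.mono_neutral_right) (auto simp: startsby_zero_power_prefix)
  then show ?thesis by (simp add: fps_compose_nth)
qed

text \<open>The counterpart for column \<open>j\<close> of \<open>toeplitz_mat n p\<close>: the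
  terms with \<open>l > j\<close> are zero and the rest is the Cauchy product.\<close>

lemma sum_toeplitz_eq_mult:
  fixes r p :: "'a::comm_ring_1 fps"
  assumes "j < n"
  shows "(\<Sum>l<n. fps_nth r l * (if l \<le> j then fps_nth p (j - l) else 0)) = fps_nth (r * p) j"
proof -
  have "(\<Sum>l<n. fps_nth r l * (if l \<le> j then fps_nth p (j - l) else 0)) =
        (\<Sum>l=0..j. fps_nth r l * (if l \<le> j then fps_nth p (j - l) else 0))"
    using assms by (intro sum.mono_neutral_right) auto
  then show ?thesis by (simp add: fps_mult_nth)
qed

text \<open>Identifies row \<open>i\<close> of a Toeplitz matrix, read as a series, with
  \<open>fps_X ^ i * p\<close>. Matrix identities can then be checked row by row as identities of
  series.\<close>

lemma toeplitz_row: "fps_nth (fps_X ^ i * p) l = (if i \<le> l then fps_nth p (l - i) else 0)"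
  for p :: "'a::comm_ring_1 fps"
  by (simp add: fps_X_power_mult_nth)

lemma toeplitz_mat_mult: "toeplitz_mat n p * toeplitz_mat n q = toeplitz_mat n (p * q)"
proof (rule eq_matI)
  fix i j assume "i < dim_row (toeplitz_mat n (p * q))" "j < dim_col (toeplitz_mat n (p * q))"
  then have ij: "i < n" "j < n" by (auto simp: toeplitz_mat_def)
  then have "(toeplitz_mat n p * toeplitz_mat n q) $$ (i, j) =
      (\<Sum>l<n. fps_nth (fps_X ^ i * p) l * (if l \<le> j then fps_nth q (j - l) else 0))"
    by (simp add: toeplitz_mat_def scalar_prod_def toeplitz_row atLeast0LessThan)
  also have "\<dots> = fps_nth (fps_X ^ i * (p * q)) j"
    using ij(2) by (simp only: sum_toeplitz_eq_mult mult.assoc)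
  also have "\<dots> = toeplitz_mat n (p * q) $$ (i, j)"
    using ij by (simp add: toeplitz_row) (simp add: toeplitz_mat_def)
  finally show "(toeplitz_mat n p * toeplitz_mat n q) $$ (i, j) = toeplitz_mat n (p * q) $$ (i, j)" .
qed (auto simp: toeplitz_mat_def)

lemma toeplitz_mat_1: "toeplitz_mat n 1 = 1\<^sub>m n"
  by (rule eq_matI) (auto simp: toeplitz_mat_def)

lemma toeplitz_mat_power: "toeplitz_mat n p ^\<^sub>m m = toeplitz_mat n (p ^ m)"
proof (induction m)
  case 0
  have "dim_row (toeplitz_mat n p) = n" by (simp add: toeplitz_mat_def)
  then show ?case by (simp add: toeplitz_mat_1)
next
  case (Suc m)
  then show ?case by (simp add: toeplitz_mat_mult mult.commute)
qed

text \<open>Substituting \<open>q\<close> is a ring homomorphism sending \<open>fps_X\<close> to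
  \<open>q\<close>. Hence row \<open>i\<close> on the left, \<open>fps_X ^ i * p\<close> with
  \<open>q\<close> substituted, is \<open>q ^ i * (p oo q)\<close>, which is row \<open>i\<close> on
  the right.\<close>

lemma toeplitz_subst_commute:
  fixes p q :: "'a::idom fps"
  assumes q: "fps_nth q 0 = 0"
  shows "toeplitz_mat n p * subst_mat n q = subst_mat n q * toeplitz_mat n (p oo q)"
proof (rule eq_matI)
  fix i j
  assume "i < dim_row (subst_mat n q * toeplitz_mat n (p oo q))"
    "j < dim_col (subst_mat n q * toeplitz_mat n (p oo q))"
  then have ij: "i < n" "j < n" by (auto simp: toeplitz_mat_def subst_mat_def)
  then have "(toeplitz_mat n p * subst_mat n q) $$ (i, j) =
      (\<Sum>l<n. fps_nth (fps_X ^ i * p) l * fps_nth (q ^ l) j)"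
    by (simp add: toeplitz_mat_def subst_mat_def scalar_prod_def toeplitz_row atLeast0LessThan)
  also have "\<dots> = fps_nth ((fps_X ^ i * p) oo q) j"
    using q ij(2) by (rule sum_fps_power_eq_compose)
  also have "(fps_X ^ i * p) oo q = q ^ i * (p oo q)"
    by (simp add: fps_compose_mult_distrib[OF q] fps_compose_power[OF q, symmetric] q)
  also have "fps_nth (q ^ i * (p oo q)) j =
      (\<Sum>l<n. fps_nth (q ^ i) l * (if l \<le> j then fps_nth (p oo q) (j - l) else 0))"
    using ij(2) by (rule sum_toeplitz_eq_mult[symmetric])
  also have "\<dots> = (subst_mat n q * toeplitz_mat n (p oo q)) $$ (i, j)"
    using ij by (simp add: toeplitz_mat_def subst_mat_def scalar_prod_def atLeast0LessThan)
  finally show "(toeplitz_mat n p * subst_mat n q) $$ (i, j) =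
      (subst_mat n q * toeplitz_mat n (p oo q)) $$ (i, j)" .
qed (auto simp: toeplitz_mat_def subst_mat_def)

text \<open>Row \<open>i\<close> of the product is \<open>p ^ i oo q\<close>, and substitution
  commutes with powers.\<close>

lemma subst_mat_mult:
  fixes p q :: "'a::idom fps"
  assumes q: "fps_nth q 0 = 0"
  shows "subst_mat n p * subst_mat n q = subst_mat n (p oo q)"
proof (rule eq_matI)
  fix i j assume "i < dim_row (subst_mat n (p oo q))" "j < dim_col (subst_mat n (p oo q))"
  then have ij: "i < n" "j < n" by (auto simp: subst_mat_def)
  then have "(subst_mat n p * subst_mat n q) $$ (i, j) =
      (\<Sum>l<n. fps_nth (p ^ i) l * fps_nth (q ^ l) j)"
    by (simp add: subst_mat_def scalar_prod_def atLeast0LessThan)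
  also have "\<dots> = fps_nth (p ^ i oo q) j" using q ij(2) by (rule sum_fps_power_eq_compose)
  also have "\<dots> = subst_mat n (p oo q) $$ (i, j)"
    using ij by (simp add: subst_mat_def fps_compose_power[OF q])
  finally show "(subst_mat n p * subst_mat n q) $$ (i, j) = subst_mat n (p oo q) $$ (i, j)" .
qed (auto simp: subst_mat_def)

lemma subst_mat_X: "subst_mat n fps_X = 1\<^sub>m n"
  by (rule eq_matI) (auto simp: subst_mat_def fps_X_power_nth)

section \<open>Polynomials evaluated at Toeplitz matrices\<close>

lemma pcompose_eq_sum:
  "pcompose p s = (\<Sum>m\<le>degree p. Polynomial.smult (coeff p m) (s ^ m))"
  for p s :: "'a::comm_ring_1 poly"
proof -
  have "pcompose p s = pcompose (\<Sum>m\<le>degree p. monom (coeff p m) m) s"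
    by (simp add: poly_as_sum_of_monoms)
  also have "\<dots> = (\<Sum>m\<le>degree p. Polynomial.smult (coeff p m) (s ^ m))"
    by (simp add: pcompose_sum monom_altdef pcompose_smult pcompose_hom.hom_power pcompose_pCons)
  finally show ?thesis .
qed

text \<open>Evaluation passes to the underlying series because \<open>toeplitz_mat n\<close> is
  linear and multiplicative. Applied twice, it turns the nested value \<open>f(g^{-1}(J))\<close>
  into a single Toeplitz matrix.\<close>

lemma poly_mat_toeplitz:
  "poly_mat p (toeplitz_mat n (fps_of_poly s)) = toeplitz_mat n (fps_of_poly (pcompose p s))"
proof (rule eq_matI)
  fix i j
  assume "i < dim_row (toeplitz_mat n (fps_of_poly (pcompose p s)))"
    "j < dim_col (toeplitz_mat n (fps_of_poly (pcompose p s)))"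
  then have ij: "i < n" "j < n" by (auto simp: toeplitz_mat_def)
  have "(toeplitz_mat n (fps_of_poly s) ^\<^sub>m m) $$ (i, j) =
      (if i \<le> j then coeff (s ^ m) (j - i) else 0)" for m
    using ij by (simp add: toeplitz_mat_power flip: fps_of_poly_power) (simp add: toeplitz_mat_def)
  then show "poly_mat p (toeplitz_mat n (fps_of_poly s)) $$ (i, j) =
      toeplitz_mat n (fps_of_poly (pcompose p s)) $$ (i, j)"
    using ij by (simp add: poly_mat_def pcompose_eq_sum coeff_sum toeplitz_mat_def)
qed (auto simp: poly_mat_def toeplitz_mat_def)

text \<open>Bridges \<open>comp_inverse\<close>, which uses the truncated inverse series, and
  conjugation, which produces the full one: the two compositions differ only from degree
  \<open>n\<close> on.\<close>

lemma toeplitz_compose_cutoff: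
  fixes h :: "'a::field fps"
  assumes "fps_nth h 0 = 0"
  shows "toeplitz_mat n (fps_of_poly (pcompose p (truncate_fps n h))) =
         toeplitz_mat n (fps_of_poly p oo h)"
proof (rule toeplitz_mat_cong)
  fix j assume j: "j < n"
  \<comment> \<open>A coefficient of a power below degree \<open>n\<close> involves only
    coefficients of the base below degree \<open>n\<close>.\<close>
  have pow: "fps_nth (fps_cutoff n h ^ l) m = fps_nth (h ^ l) m" if "m < n" for l m
    using that by (induction l arbitrary: m) (auto simp: fps_mult_nth intro!: sum.cong)
  have "coeff (truncate_fps n h) 0 = 0" using assms j by (simp add: coeff_truncate_fps)
  then have "fps_of_poly (pcompose p (truncate_fps n h)) = fps_of_poly p oo fps_cutoff n h"
    by (simp add: fps_of_poly_pcompose)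
  then show "fps_nth (fps_of_poly (pcompose p (truncate_fps n h))) j = fps_nth (fps_of_poly p oo h) j"
    using j by (simp add: fps_compose_nth pow)
qed

subsection \<open>A single block\<close>

text \<open>The linear coefficient is assumed nonzero for every \<open>n\<close>, so that
  \<open>h\<close> is a two-sided compositional inverse of the full series \<open>G\<close> and no
  congruence modulo \<open>x^n\<close> has to be carried along.\<close>

lemma jordan_block_conjugation:
  fixes f :: "'a::field poly"
  assumes c1: "coeff ([:c, 1:] + Polynomial.smult z f) 1 \<noteq> 0"
  defines "g \<equiv> [:c, 1:] + Polynomial.smult z f"
  defines "\<mu> \<equiv> c + z * coeff f 0"
  shows "\<exists>S \<in> carrier_mat n n. \<exists>R \<in> carrier_mat n n. S * R = 1\<^sub>m n \<and> R * S = 1\<^sub>m n \<and>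
    R * (jordan_block n c + z \<cdot>\<^sub>m poly_mat f (jordan_block n 0)) * S = jordan_block n \<mu> \<and>
    R * poly_mat f (jordan_block n 0) * S =
      poly_mat f (poly_mat (comp_inverse n g) (jordan_block n \<mu>))"
proof -
  define G where "G = fps_of_poly (g - [:coeff g 0:])"
  define h where "h = fps_inv G"
  have g0: "coeff g 0 = \<mu>" by (simp add: g_def \<mu>_def)
  have G: "fps_nth G 0 = 0" "fps_nth G 1 \<noteq> 0"
    using c1 by (simp_all add: G_def g_def)
  have h0: "fps_nth h 0 = 0" by (simp add: h_def fps_inv_def)
  have hG: "h oo G = fps_X" and Gh: "G oo h = fps_X"
    unfolding h_def using G by (simp_all add: fps_inv fps_inv_right)
  define S where "S = subst_mat n h"
  define R where "R = subst_mat n G"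
  have car [simp]: "S \<in> carrier_mat n n" "R \<in> carrier_mat n n" by (simp_all add: S_def R_def)
  have SR: "S * R = 1\<^sub>m n" and RS: "R * S = 1\<^sub>m n"
    by (simp_all add: S_def R_def subst_mat_mult G h0 hG Gh subst_mat_X)
  have conj: "R * toeplitz_mat n p * S = toeplitz_mat n (p oo h)" for p
  proof -
    have "R * toeplitz_mat n p * S = R * (toeplitz_mat n p * S)"
      by (rule assoc_mult_mat[of _ n n _ n _ n]) auto
    also have "\<dots> = R * (S * toeplitz_mat n (p oo h))"
      by (simp add: S_def toeplitz_subst_commute h0)
    also have "\<dots> = R * S * toeplitz_mat n (p oo h)"
      by (rule assoc_mult_mat[of _ n n _ n _ n, symmetric]) auto
    finally show ?thesis by (simp add: RS left_mult_one_mat[of _ n n])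
  qed
  have A: "poly_mat f (jordan_block n 0) = toeplitz_mat n (fps_of_poly f)"
    by (simp only: jordan_block_eq_toeplitz poly_mat_toeplitz pcompose_idR)
  have M: "jordan_block n c + z \<cdot>\<^sub>m poly_mat f (jordan_block n 0) = toeplitz_mat n (fps_of_poly g)"
    unfolding A unfolding jordan_block_eq_toeplitz toeplitz_mat_add_smult
    by (simp add: g_def fps_of_poly_add fps_of_poly_smult)
  \<comment> \<open>Substituting \<open>h\<close> turns \<open>G\<close> into \<open>fps_X\<close>
    and fixes the constant, leaving the series \<mu> + x of the new Jordan block.\<close>
  have "fps_of_poly g = G + fps_const \<mu>"
    by (simp add: G_def g0 fps_of_poly_diff)
  then have "fps_of_poly g oo h = fps_of_poly [:\<mu>, 1:]"
    by (simp add: fps_compose_add_distrib Gh fps_of_poly_pCons)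
  then have 1: "R * (jordan_block n c + z \<cdot>\<^sub>m poly_mat f (jordan_block n 0)) * S = jordan_block n \<mu>"
    unfolding M conj by (simp only: jordan_block_eq_toeplitz)
  \<comment> \<open>\<open>comp_inverse n g\<close> is a polynomial in t - \<mu>; inserting t =
    \<mu> + x cancels the shift and leaves the truncation of \<open>h\<close>.\<close>
  have "pcompose (comp_inverse n g) [:\<mu>, 1:] = truncate_fps n h"
    by (simp add: comp_inverse_def pcompose_shift h_def G_def g0)
  then have 2: "R * poly_mat f (jordan_block n 0) * S =
      poly_mat f (poly_mat (comp_inverse n g) (jordan_block n \<mu>))"
    by (simp only: A conj jordan_block_eq_toeplitz[of n \<mu>] poly_mat_toeplitz
        toeplitz_compose_cutoff[OF h0])
  show ?thesis
    by (intro bexI[of _ S] bexI[of _ R] conjI SR RS 1 2 car)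
qed

subsection \<open>Block diagonal matrices\<close>

lemma diag_block_mat_carrier:
  assumes "\<And>i. i \<in> set is \<Longrightarrow> F i \<in> carrier_mat (n i) (n i)"
  shows "diag_block_mat (map F is) \<in> carrier_mat (sum_list (map n is)) (sum_list (map n is))"
  using assms by (induction "is") (auto simp: Let_def)

text \<open>Splitting off the first block gives 2 by 2 block matrices with zero corners, whose block
  product reduces the claim to the tail.\<close>

lemma diag_block_mat_mult:
  assumes "\<And>i. i \<in> set is \<Longrightarrow> F i \<in> carrier_mat (n i) (n i)"
    and "\<And>i. i \<in> set is \<Longrightarrow> H i \<in> carrier_mat (n i) (n i)"
  shows "diag_block_mat (map F is) * diag_block_mat (map H is) =
         diag_block_mat (map (\<lambda>i. F i * H i) is)"
  using assms
proof (induction "is")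
  case (Cons i "is")
  let ?m = "sum_list (map n is)"
  have car: "diag_block_mat (map F is) \<in> carrier_mat ?m ?m"
    "diag_block_mat (map H is) \<in> carrier_mat ?m ?m"
    "diag_block_mat (map (\<lambda>i. F i * H i) is) \<in> carrier_mat ?m ?m"
    using Cons.prems by (auto intro!: diag_block_mat_carrier intro: mult_carrier_mat)
  moreover have "F i \<in> carrier_mat (n i) (n i)" "H i \<in> carrier_mat (n i) (n i)"
    using Cons.prems by auto
  moreover have "diag_block_mat (map F is) * diag_block_mat (map H is) =
         diag_block_mat (map (\<lambda>i. F i * H i) is)"
    using Cons by auto
  ultimately show ?case
    by (simp add: Let_def mult_four_block_mat[of _ "n i" "n i" _ ?m _ ?m _ _ "n i" _ ?m])
qed simp

lemma diag_block_mat_add_smult: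
  fixes c :: "'a::comm_ring_1"
  assumes "\<And>i. i \<in> set is \<Longrightarrow> F i \<in> carrier_mat (n i) (n i)"
    and "\<And>i. i \<in> set is \<Longrightarrow> H i \<in> carrier_mat (n i) (n i)"
  shows "diag_block_mat (map F is) + c \<cdot>\<^sub>m diag_block_mat (map H is) =
         diag_block_mat (map (\<lambda>i. F i + c \<cdot>\<^sub>m H i) is)"
  using assms
proof (induction "is")
  case (Cons i "is")
  let ?m = "sum_list (map n is)"
  have car: "diag_block_mat (map F is) \<in> carrier_mat ?m ?m"
    "diag_block_mat (map H is) \<in> carrier_mat ?m ?m"
    "diag_block_mat (map (\<lambda>i. F i + c \<cdot>\<^sub>m H i) is) \<in> carrier_mat ?m ?m"
    using Cons.prems by (auto intro!: diag_block_mat_carrier)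
  moreover have "F i \<in> carrier_mat (n i) (n i)" "H i \<in> carrier_mat (n i) (n i)"
    using Cons.prems by auto
  moreover have "diag_block_mat (map F is) + c \<cdot>\<^sub>m diag_block_mat (map H is) =
         diag_block_mat (map (\<lambda>i. F i + c \<cdot>\<^sub>m H i) is)"
    using Cons by auto
  ultimately show ?case
    by (simp add: Let_def smult_four_block_mat[of _ "n i" "n i" _ ?m _ ?m]
        add_four_block_mat[of _ "n i" "n i" _ ?m _ ?m])
qed simp

lemma diag_block_mat_one: "diag_block_mat (map (\<lambda>i. 1\<^sub>m (n i)) is) = 1\<^sub>m (sum_list (map n is))"
  by (induction "is") (auto simp: Let_def)

subsection \<open>SLOCC equivalence\<close>

text \<open>Taking P = \<open>R\<close> and Q = \<open>S\<close> conjugates all three matrices and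
  fixes the identity; T only has to mix \<open>z\<close> times the third matrix into the
  second.\<close>

lemma slocc_equiv_conjugation:
  assumes "S \<in> carrier_mat N N" "R \<in> carrier_mat N N" "S * R = 1\<^sub>m N" "R * S = 1\<^sub>m N"
    and J: "J \<in> carrier_mat N N" and A: "A \<in> carrier_mat N N"
    and J': "R * (J + z \<cdot>\<^sub>m A) * S = J'" and A': "R * A * S = A'"
  shows "slocc_equiv N (1\<^sub>m N, J, A) (1\<^sub>m N, J', A')"
proof -
  \<comment> \<open>With indices from 0, the entry (1, 2) adds \<open>z\<close> times the third
    matrix to the second; the opposite shear \<open>T'\<close> is its inverse.\<close>
  define T where "T = mat 3 3 (\<lambda>(i, j). if i = j then 1 else if i = 1 \<and> j = 2 then z else 0)"
  define T' where "T' = mat 3 3 (\<lambda>(i, j). if i = j then 1 else if i = 1 \<and> j = 2 then - z else 0)"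
  have "T * T' = 1\<^sub>m 3" "T' * T = 1\<^sub>m 3"
    by (rule eq_matI; auto simp: T_def T'_def scalar_prod_def numeral_3_eq_3 less_Suc_eq)+
  then have invT: "invertible_mat T"
    unfolding invertible_mat_def inverts_mat_def by (auto simp: T_def T'_def intro!: exI[of _ T'])
  have invS: "invertible_mat S" and invR: "invertible_mat R"
    using assms unfolding invertible_mat_def inverts_mat_def by auto
  have RJS: "R * J * S \<in> carrier_mat N N" and RAS: "R * A * S \<in> carrier_mat N N"
    and RES: "R * 1\<^sub>m N * S = 1\<^sub>m N"
    using assms by auto
  have "R * (J + z \<cdot>\<^sub>m A) = R * J + z \<cdot>\<^sub>m (R * A)"
    using assms by (simp add: mult_add_distrib_mat[of _ N N _ N] mult_smult_distrib[of _ N N _ N])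
  then have sum: "R * J * S + z \<cdot>\<^sub>m (R * A * S) = J'"
    using assms by (auto simp: add_mult_distrib_mat[of _ N N _ _ N] mult_smult_assoc_mat[of _ N N _ N])
  \<comment> \<open>One equation for each of the three rows of \<open>T\<close>.\<close>
  have lin: "1 \<cdot>\<^sub>m X + 0 \<cdot>\<^sub>m Y + 0 \<cdot>\<^sub>m Z = X" "0 \<cdot>\<^sub>m X + 1 \<cdot>\<^sub>m Y + z \<cdot>\<^sub>m Z = Y + z \<cdot>\<^sub>m Z"
    "0 \<cdot>\<^sub>m X + 0 \<cdot>\<^sub>m Y + 1 \<cdot>\<^sub>m Z = Z"
    if "X \<in> carrier_mat N N" "Y \<in> carrier_mat N N" "Z \<in> carrier_mat N N" for X Y Z
    using that by (auto intro!: eq_matI)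
  have "T $$ (i, 0) \<cdot>\<^sub>m (R * 1\<^sub>m N * S) + T $$ (i, 1) \<cdot>\<^sub>m (R * J * S) + T $$ (i, 2) \<cdot>\<^sub>m (R * A * S)
      = [1\<^sub>m N, J', A'] ! i" if "i < 3" for i
  proof -
    consider "i = 0" | "i = 1" | "i = 2" using \<open>i < 3\<close> by linarith
    then show ?thesis
      by cases (use RJS RAS in \<open>simp_all add: RES A' lin T_def sum[unfolded A']\<close>)
  qed
  moreover have "T \<in> carrier_mat 3 3" by (simp add: T_def)
  moreover have "J' \<in> carrier_mat N N" "A' \<in> carrier_mat N N" using J' A' assms by auto
  ultimately show ?thesis
    unfolding slocc_equiv_def using assms(1,2) J A invT invS invR by auto
qed

section \<open>Assembling the blocks\<close>

theorem mainTheorem3: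
  fixes k N :: nat and n :: "nat \<Rightarrow> nat"
    and lam :: "nat \<Rightarrow> complex" and a :: "nat \<Rightarrow> nat \<Rightarrow> complex" and z3 :: complex
    and f g :: "nat \<Rightarrow> complex poly" and J A J' A' :: "complex mat"
  defines "N \<equiv> \<Sum>i<k. n i"
    and "f \<equiv> \<lambda>i. \<Sum>m<n i. monom (a i m) m"
    and "g \<equiv> \<lambda>i. [:lam i, 1:] + Polynomial.smult z3 (f i)"
    and "J \<equiv> diag_block_mat (map (\<lambda>i. jordan_block (n i) (lam i)) [0..<k])"
    and "A \<equiv> diag_block_mat (map (\<lambda>i. poly_mat (f i) (jordan_block (n i) 0)) [0..<k])"
    and "J' \<equiv> diag_block_mat (map (\<lambda>i. jordan_block (n i) (lam i + z3 * a i 0)) [0..<k])"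
    and "A' \<equiv> diag_block_mat (map (\<lambda>i.
           poly_mat (f i) (poly_mat (comp_inverse (n i) (g i))
             (jordan_block (n i) (lam i + z3 * a i 0)))) [0..<k])"
  assumes "\<forall>i<k. n i \<ge> 1"
    and "\<forall>i<k. n i \<ge> 2 \<longrightarrow> 1 + z3 * a i 1 \<noteq> 0"
  shows "(\<exists>S \<in> carrier_mat N N. \<exists>S_inv \<in> carrier_mat N N.
            inverts_mat S S_inv \<and> inverts_mat S_inv S \<and>
            S_inv * (J + z3 \<cdot>\<^sub>m A) * S = J' \<and> S_inv * A * S = A') \<and>
         slocc_equiv N (1\<^sub>m N, J, A) (1\<^sub>m N, J', A')"
proof -
  let ?J = "\<lambda>i. jordan_block (n i) (lam i)" and ?A = "\<lambda>i. poly_mat (f i) (jordan_block (n i) 0)"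
  let ?J' = "\<lambda>i. jordan_block (n i) (lam i + z3 * a i 0)"
  let ?A' = "\<lambda>i. poly_mat (f i) (poly_mat (comp_inverse (n i) (g i)) (?J' i))"
  have coeff_f: "coeff (f i) m = (if m < n i then a i m else 0)" for i m
    by (auto simp: f_def coeff_sum)
  have "\<exists>S R. S \<in> carrier_mat (n i) (n i) \<and> R \<in> carrier_mat (n i) (n i) \<and>
      S * R = 1\<^sub>m (n i) \<and> R * S = 1\<^sub>m (n i) \<and>
      R * (?J i + z3 \<cdot>\<^sub>m ?A i) * S = ?J' i \<and> R * ?A i * S = ?A' i" if i: "i < k" for i
  proof -
    \<comment> \<open>For \<open>n i = 1\<close> the polynomial \<open>f i\<close> is constant, so
      this coefficient is 1; for larger blocks it is the assumed nonzero number.\<close>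
    have "coeff ([:lam i, 1:] + Polynomial.smult z3 (f i)) 1 \<noteq> 0"
      using assms(9) i by (auto simp: coeff_f)
    moreover have "coeff (f i) 0 = a i 0"
      using assms(8) i by (auto simp: coeff_f)
    ultimately show ?thesis
      using jordan_block_conjugation[of "lam i" z3 "f i" "n i"] unfolding g_def by auto
  qed
  then obtain S R where SR: "\<And>i. i < k \<Longrightarrow> S i \<in> carrier_mat (n i) (n i) \<and> R i \<in> carrier_mat (n i) (n i) \<and>
      S i * R i = 1\<^sub>m (n i) \<and> R i * S i = 1\<^sub>m (n i) \<and>
      R i * (?J i + z3 \<cdot>\<^sub>m ?A i) * S i = ?J' i \<and> R i * ?A i * S i = ?A' i"
    by metis
  let ?D = "\<lambda>F. diag_block_mat (map F [0..<k]) :: complex mat"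
  have N: "N = sum_list (map n [0..<k])"
    by (simp add: N_def interv_sum_list_conv_sum_set_nat atLeast0LessThan)
  have carD: "?D F \<in> carrier_mat N N" if "\<And>i. i < k \<Longrightarrow> F i \<in> carrier_mat (n i) (n i)" for F
    unfolding N using that by (intro diag_block_mat_carrier) auto
  have multD: "?D F * ?D H = ?D (\<lambda>i. F i * H i)"
    if "\<And>i. i < k \<Longrightarrow> F i \<in> carrier_mat (n i) (n i)" "\<And>i. i < k \<Longrightarrow> H i \<in> carrier_mat (n i) (n i)"
    for F H
    using that by (intro diag_block_mat_mult) auto
  \<comment> \<open>The chosen \<open>S i\<close> and \<open>R i\<close> are controlled only for
    \<open>i < k\<close>, so blocks are compared only at those indices.\<close>
  have congD: "?D F = ?D H" if "\<And>i. i < k \<Longrightarrow> F i = H i" for F H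
    using that by (intro arg_cong[of _ _ diag_block_mat]) auto
  have blocks: "?J i \<in> carrier_mat (n i) (n i)" "?A i \<in> carrier_mat (n i) (n i)" for i
    by (auto simp: poly_mat_def)
  have S: "?D S \<in> carrier_mat N N" and R: "?D R \<in> carrier_mat N N"
    and J: "J \<in> carrier_mat N N" and A: "A \<in> carrier_mat N N"
    unfolding J_def A_def using SR blocks by (auto intro!: carD)
  have "?D S * ?D R = ?D (\<lambda>i. 1\<^sub>m (n i))" "?D R * ?D S = ?D (\<lambda>i. 1\<^sub>m (n i))"
    using SR by (auto simp: multD intro!: congD)
  then have inv: "?D S * ?D R = 1\<^sub>m N" "?D R * ?D S = 1\<^sub>m N"
    by (simp_all add: N diag_block_mat_one)
  have conj: "?D R * ?D F * ?D S = ?D (\<lambda>i. R i * F i * S i)"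
    if F: "\<And>i. F i \<in> carrier_mat (n i) (n i)" for F
  proof -
    have "?D R * ?D F = ?D (\<lambda>i. R i * F i)" using SR F by (intro multD) auto
    moreover have "R i * F i \<in> carrier_mat (n i) (n i)" if "i < k" for i
      using SR[OF that] F[of i] by (intro mult_carrier_mat) auto
    ultimately show ?thesis using SR by (simp add: multD)
  qed
  \<comment> \<open>The scalar \<open>z3\<close> is the same in every block, so the sum is again
    block diagonal and the blockwise conjugations apply to it.\<close>
  have JA: "J + z3 \<cdot>\<^sub>m A = ?D (\<lambda>i. ?J i + z3 \<cdot>\<^sub>m ?A i)"
    unfolding J_def A_def using blocks by (intro diag_block_mat_add_smult)
  have J': "?D R * (J + z3 \<cdot>\<^sub>m A) * ?D S = J'"
    unfolding JA J'_def using SR blocks by (subst conj) (auto intro!: congD)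
  have A': "?D R * A * ?D S = A'"
    unfolding A_def A'_def using SR blocks by (subst conj) (auto intro!: congD)
  have "inverts_mat (?D S) (?D R)" "inverts_mat (?D R) (?D S)"
    using inv S R by (auto simp: inverts_mat_def)
  then show ?thesis
    using slocc_equiv_conjugation[OF S R inv J A J' A'] S R J' A' by blast
qed

end
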